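(* Let $(\mathbf{Q},\mathbf{B})$ be a $(K_1,K_2,K';F,F';Z_1,Z_2,Z';\mathcal{S},\mathcal{S}_1,\ldots,\mathcal{S}_{K_1})$ hierarchical hotplug placement delivery array (HHPDA). Then the placement and delivery procedure called "the Algorithm" in the context, applied to $(\mathbf{Q},\mathbf{B})$, gives a $(K_1,K_2,K';M_1,M_2;N)$ hotplug hierarchical coded caching scheme with subpacketization level $F'$, memory ratios $$\frac{M_1}{N}=\frac{Z_1}{F'},\qquad \frac{M_2}{N}=\frac{Z_2}{F'},$$ and transmission loads $$R_1=\frac{|\mathcal{S}|}{F'},\qquad R_2=\frac{1}{F'}\max_{k_1\in[K_1]}\left\{\left|\bigcup_{j\in[K'],\ \phi^{-1}(j)\in\mathcal{U}'_{k_1}}\mathcal{S}^{(j)}\right|+\left|\bigcup_{k_2\in[K_2],\ (k_1,k_2)\in\mathcal{U}'_{k_1}}\mathcal{S}_{k_1}^{(k_2,\zeta)}\right|\right\}.$$ Here $\mathcal{U}'\subseteq[K_1]\times[K_2]$, $|\mathcal{U}'|=K'$, is the set of active users, arranged in lexicographic order of $(k_1,k_2)$; $\phi:\mathcal{U}'\to[K']$ is the corresponding bijection; $\mathcal{U}'_{k_1}\subseteq\mathcal{U}'$ is the set of active users attached to mirror $k_1$; $\mathcal{S}^{(j)}\subseteq\mathcal{S}$ is the set of integers appearing in the $j$-th column of $\mathbf{B}$; $\zeta\subseteq[F]$, $|\zeta|=F'$, is the set chosen by the Algorithm for $\mathcal{U}'$; and $\mathcal{S}_{k_1}^{(k_2,\zeta)}\subseteq\mathcal{S}_{k_1}$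 is the set of integers appearing in the $k_2$-th column and the rows indexed by $f\in\zeta$ of $\mathbf{Q}^{(k_1)}$.
   Context: Notation: $[n]=\{1,\ldots,n\}$. **PDA.** A $(K,F,Z,S)$ placement delivery array is an $F\times K$ array $(p_{j,k})$ whose entries are the symbol $\star$ or one of $S$ integers (which may be taken from any fixed set of $S$ integers) such that: (C1) $\star$ appears exactly $Z$ times in each column; (C2) each of the $S$ integers occurs at least once; (C3) if two distinct entries $p_{j_1,k_1}=p_{j_2,k_2}$ are the same integer, then $j_1\ne j_2$, $k_1\neq k_2$ and $p_{j_1,k_2}=p_{j_2,k_1}=\star$. **HHPDA.** Let $K_1,K_2,K',F,F',Z_1,Z_2,Z'$ be positive integers with $Z_1+Z_2<F'\le F$ and $K'\le K_1K_2$, and let $\mathcal{S},\mathcal{S}_1,\ldots,\mathcal{S}_{K_1}$ be integer sets with $\mathcal{S}\cap\mathcal{S}_{k_1}=\emptyset$ for all $k_1\in[K_1]$. A $(K_1,K_2,K';F,F';Z_1,Z_2,Z';\mathcal{S},\mathcal{S}_1,\ldots,\mathcal{S}_{K_1})$ HHPDA is a pair $(\mathbf{Q},\mathbf{B})$ as follows. (i) $\mathbf{Q}=(\mathbf{Q}^{(0)},\mathbf{Q}^{(1)},\ldots,\mathbf{Q}^{(K_1)})$ is an $F\times(K_1+K_1K_2)$ array, where $\mathbf{Q}^{(0)}=(q^{(0)}_{f,k_1})_{f\in[F],k_1\in[K_1]}$ has entries in $\{\star,\text{null}\}$ and, for $k_1\in[K_1]$, $\mathbf{Q}^{(k_1)}=(q^{(k_1)}_{f,k_2})_{f\in[F],k_2\in[K_2]}$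 has entries in $\{\star\}\cup\{\text{null}\}\cup\mathcal{S}_{k_1}$, such that: - (A1) each column of $\mathbf{Q}^{(0)}$ has $Z_1$ stars; - (A2) each column of each $\mathbf{Q}^{(k_1)}$, $k_1\in[K_1]$, has $Z_2$ stars; - (A3) each integer $s\in\mathcal{S}_{k_1}$ occurs in exactly the subarray $\mathbf{Q}^{(k_1)}$ (and in no other); and if $q^{(0)}_{f,k_1}=\star$ then $q^{(k_1)}_{f,k_2}\in\{\star\}\cup\mathcal{S}_{k_1}$, for all $f\in[F]$, $k_1\in[K_1]$, $k_2\in[K_2]$; - (A4) for two distinct entries of the same $\mathbf{Q}^{(k_1)}$, $q^{(k_1)}_{f,k_i}=q^{(k_1)}_{f',k_j}=s\in\mathcal{S}_{k_1}$ only if $f\ne f'$, $k_i\ne k_j$ and $q^{(k_1)}_{f,k_j}=q^{(k_1)}_{f',k_i}=\star$. (ii) $\mathbf{B}=(b_{f',k})_{f'\in[F'],k\in[K']}$ is a $(K',F',Z',|\mathcal{S}|)$ PDA whose integers are the elements of $\mathcal{S}$. (iii) For each $\tau\subseteq[K_1]\times[K_2]$ with $|\tau|=K'$ there is a subset $\zeta\subseteq[F]$ with $|\zeta|=F'$, its elements listed in some order (not necessarily increasing), such that $\mathbf{Q}'_{\zeta,\tau}\stackrel{\star}{=}\mathbf{B}$. Here $\mathbf{Q}'_{\zeta,\tau}$ is the $F'\times K'$ array with rows indexed by $\zeta$ (in the given order) and columns by $\tau$ (in lexicographic order), whose entry at $(f',(k_1,k_2))$ is $\star$ if $q^{(0)}_{f',k_1}=\star$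 or $q^{(k_1)}_{f',k_2}=\star$, and null otherwise; and $\stackrel{\star}{=}$ means that the stars are in the same positions in both arrays. **Hotplug hierarchical coded caching.** A server holds $N$ files $W_1,\ldots,W_N$ of $B$ bits each and is connected by an error-free broadcast link to $K_1$ mirrors, each with a cache of size $M_1$ files. Mirror $k_1$ is connected by an error-free broadcast link to $K_2$ users $(k_1,k_2)$, $k_2\in[K_2]$, each with a cache of size $M_2$ files. In the placement phase all caches are filled, knowing the number $K'$ of users that will be active but neither their identity nor their demands. In the delivery phase a set $\mathcal{U}'\subseteq[K_1]\times[K_2]$ of $K'$ active users and a demand vector $\vec d=(d_1,\ldots,d_{K'})$ are revealed, the $j$-th active user in lexicographic order wanting file $W_{d_j}$. The server broadcasts to the mirrors, then each mirror broadcasts to its users, and each active user must recover its demanded file from its own mirror's transmissions and its own cache. The load $R_1$ is the size of the server's transmission and $R_2$ is the maximum over mirrors of the size of the mirror's transmission, both measured in files. The subpacketization level is the number of packets into which each file is split. A $(K_1,K_2,K';M_1,M_2;N)$ hotplug hierarchical coded caching scheme is a scheme of this kind that works for every $\mathcal{U}'$ and every $\vec d$. **The Algorithm.** *Placement.* Split each file $W_n$ into $F'$ packets $W_{n,1},\ldots,W_{n,F'}$ of equal size. Encode them into $F$ coded packets $C_{n,1},\ldots,C_{n,F}$ (each of the size of a packet) by an $[F,F']$ MDS code with $F'\times F$ generator matrix $G$, i.e. $(C_{n,1},\ldots,C_{n,F})^T=G^T(W_{n,1},\ldots,W_{n,F'})^T$; thus any $F'$ of the coded packets of a file determine the file. (The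 packets are large enough for such a code to exist over the packet alphabet.) Mirror $k_1$ caches $\{C_{n,f}: q^{(0)}_{f,k_1}=\star,\ n\in[N],\ f\in[F]\}$. User $(k_1,k_2)$ caches $\{C_{n,f}: q^{(k_1)}_{f,k_2}=\star,\ n\in[N],\ f\in[F]\}$. *Delivery by the server.* Given $\mathcal{U}'$ and $\vec d$, find $\zeta\subseteq[F]$, $|\zeta|=F'$, with $\mathbf{Q}'_{\zeta,\mathcal{U}'}\stackrel{\star}{=}\mathbf{B}$. Form the array $\overline{\mathbf{Q}}=(\overline q_{f,k})_{f\in\zeta,k\in[K']}$ by filling the null entries of $\mathbf{Q}'_{\zeta,\mathcal{U}'}$ with integers of $\mathcal{S}$ so that $\overline{\mathbf{Q}}=\mathbf{B}$. For each $s\in\mathcal{S}$ the server sends to the mirrors $$X_s=\bigoplus_{f\in\zeta,\,k\in[K'],\ \overline q_{f,k}=s} C_{d_k,f}.$$ *Delivery by mirror $k_1$.* With $\phi$, $\mathcal{U}'_{k_1}$, $\mathcal{S}^{(j)}$ and $\mathcal{S}_{k_1}^{(k_2,\zeta)}$ as in the claim: - for each $s$ lying in $\mathcal{S}^{(j)}$ for some $j$ with $\phi^{-1}(j)\in\mathcal{U}'_{k_1}$, mirror $k_1$ sends to its users $$X_{k_1,s}=X_s\oplus\bigoplus_{\substack{f\in\zeta,\ k'\in[K']\setminus\phi(\mathcal{U}'_{k_1}),\\ q^{(0)}_{f,k_1}=\star,\ \overline q_{f,k'}=s}} C_{d_{k'},f};$$ - for each $s'$ lying in $\mathcal{S}_{k_1}^{(k_2,\zeta)}$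 for some $k_2$ with $(k_1,k_2)\in\mathcal{U}'_{k_1}$, mirror $k_1$ sends to its users $$X_{k_1,s'}=\bigoplus_{\substack{f\in\zeta,\ (k_1,k_2)\in\mathcal{U}'_{k_1},\\ q^{(k_1)}_{f,k_2}=s'}} C_{d_j,f},\qquad j=\phi((k_1,k_2)).$$
   Formalization: That mirror k1 can form X_{k1,s'} from the server's transmission and its own cache is proved only when the rows f of the summed packets have q^{(0)}_{f,k1}=★; condition (A3) does not ensure this, and without it the mirror may be unable to form the packet. *)

theory Defs
  imports Complex_Main "HOL-Library.Cardinality" "HOL-Library.FuncSet"
begin

text \<open>Arrays are functions of a row and a column index, both counted from 1; only the
  entries inside the stated ranges matter.\<close>

datatype entry = Star | Null | Num int

text \<open>\<open>T\<close> is the set of integers used, so that \<open>is_PDA K F Z T P\<close> says that \<open>P\<close> is a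
  \<open>(K, F, Z, card T)\<close> PDA whose integers are the elements of \<open>T\<close>. As each element of \<open>T\<close> occurs,
  \<open>T\<close> is finite.\<close>

definition is_PDA :: "nat \<Rightarrow> nat \<Rightarrow> nat \<Rightarrow> int set \<Rightarrow> (nat \<Rightarrow> nat \<Rightarrow> entry) \<Rightarrow> bool" where
  "is_PDA K F Z T P \<longleftrightarrow>
     (\<forall>j\<in>{1..F}. \<forall>k\<in>{1..K}. P j k \<in> {Star} \<union> Num ` T) \<and>
     (\<forall>k\<in>{1..K}. card {j\<in>{1..F}. P j k = Star} = Z) \<and>
     (\<forall>s\<in>T. \<exists>j\<in>{1..F}. \<exists>k\<in>{1..K}. P j k = Num s) \<and>
     (\<forall>j1\<in>{1..F}. \<forall>j2\<in>{1..F}. \<forall>k1\<in>{1..K}. \<forall>k2\<in>{1..K}. \<forall>s.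
        (j1, k1) \<noteq> (j2, k2) \<and> P j1 k1 = Num s \<and> P j2 k2 = Num s \<longrightarrow>
        j1 \<noteq> j2 \<and> k1 \<noteq> k2 \<and> P j1 k2 = Star \<and> P j2 k1 = Star)"

definition active_set :: "nat \<Rightarrow> nat \<Rightarrow> nat \<Rightarrow> (nat \<times> nat) set \<Rightarrow> bool" where
  "active_set K1 K2 K' U \<longleftrightarrow> U \<subseteq> {1..K1} \<times> {1..K2} \<and> card U = K'"

text \<open>The bijection \<open>\<phi>\<close> from \<open>U\<close> to \<open>{1..card U}\<close>: the lexicographic rank.\<close>

definition lex_pos :: "(nat \<times> nat) set \<Rightarrow> nat \<times> nat \<Rightarrow> nat" where
  "lex_pos U u = Suc (card {v \<in> U. (v, u) \<in> less_than <*lex*> less_than})"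

definition nth_user :: "(nat \<times> nat) set \<Rightarrow> nat \<Rightarrow> nat \<times> nat" where
  "nth_user U j = inv_into U (lex_pos U) j"

definition users_of :: "(nat \<times> nat) set \<Rightarrow> nat \<Rightarrow> (nat \<times> nat) set" where
  "users_of U k1 = {u \<in> U. fst u = k1}"

text \<open>\<open>Q0\<close> is the mirror array, \<open>Q k1\<close> the user array below mirror \<open>k1\<close>.\<close>

definition merged :: "(nat \<Rightarrow> nat \<Rightarrow> entry) \<Rightarrow> (nat \<Rightarrow> nat \<Rightarrow> nat \<Rightarrow> entry) \<Rightarrow>
    nat \<Rightarrow> nat \<times> nat \<Rightarrow> entry" where
  "merged Q0 Q f u =
     (if Q0 f (fst u) = Star \<or> Q (fst u) f (snd u) = Star then Star else Null)"

text \<open>\<open>z\<close> lists, in some order, an \<open>F'\<close>-element set \<open>\<zeta>\<close> of rows for which the array with rows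
  \<open>\<zeta>\<close> and columns \<open>U\<close> has its stars in the same positions as \<open>B\<close>.\<close>

definition row_listing :: "nat \<Rightarrow> nat \<Rightarrow> nat \<Rightarrow> (nat \<Rightarrow> nat \<Rightarrow> entry) \<Rightarrow>
    (nat \<Rightarrow> nat \<Rightarrow> nat \<Rightarrow> entry) \<Rightarrow> (nat \<Rightarrow> nat \<Rightarrow> entry) \<Rightarrow>
    (nat \<times> nat) set \<Rightarrow> (nat \<Rightarrow> nat) \<Rightarrow> bool" where
  "row_listing K' F F' Q0 Q B U z \<longleftrightarrow>
     (\<exists>\<zeta> \<subseteq> {1..F}. card \<zeta> = F' \<and> bij_betw z {1..F'} \<zeta>) \<and>
     (\<forall>i\<in>{1..F'}. \<forall>j\<in>{1..K'}. merged Q0 Q (z i) (nth_user U j) = Star \<longleftrightarrow> B i j = Star)"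

definition is_HHPDA :: "nat \<Rightarrow> nat \<Rightarrow> nat \<Rightarrow> nat \<Rightarrow> nat \<Rightarrow> nat \<Rightarrow> nat \<Rightarrow> nat \<Rightarrow> int set \<Rightarrow>
    (nat \<Rightarrow> int set) \<Rightarrow> (nat \<Rightarrow> nat \<Rightarrow> entry) \<Rightarrow> (nat \<Rightarrow> nat \<Rightarrow> nat \<Rightarrow> entry) \<Rightarrow>
    (nat \<Rightarrow> nat \<Rightarrow> entry) \<Rightarrow> bool" where
  "is_HHPDA K1 K2 K' F F' Z1 Z2 Z' S Sm Q0 Q B \<longleftrightarrow>
     0 < K1 \<and> 0 < K2 \<and> 0 < K' \<and> 0 < F \<and> 0 < F' \<and> 0 < Z1 \<and> 0 < Z2 \<and> 0 < Z' \<and>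
     Z1 + Z2 < F' \<and> F' \<le> F \<and> K' \<le> K1 * K2 \<and>
     (\<forall>k1\<in>{1..K1}. S \<inter> Sm k1 = {}) \<and>
     (\<forall>f\<in>{1..F}. \<forall>k1\<in>{1..K1}. Q0 f k1 \<in> {Star, Null}) \<and>
     (\<forall>k1\<in>{1..K1}. \<forall>f\<in>{1..F}. \<forall>k2\<in>{1..K2}. Q k1 f k2 \<in> {Star, Null} \<union> Num ` Sm k1) \<and>
     (\<forall>k1\<in>{1..K1}. card {f\<in>{1..F}. Q0 f k1 = Star} = Z1) \<and>
     (\<forall>k1\<in>{1..K1}. \<forall>k2\<in>{1..K2}. card {f\<in>{1..F}. Q k1 f k2 = Star} = Z2) \<and>
     (\<forall>k1\<in>{1..K1}. \<forall>s\<in>Sm k1.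
        (\<exists>f\<in>{1..F}. \<exists>k2\<in>{1..K2}. Q k1 f k2 = Num s) \<and>
        (\<forall>k\<in>{1..K1}. k \<noteq> k1 \<longrightarrow> (\<forall>f\<in>{1..F}. \<forall>k2\<in>{1..K2}. Q k f k2 \<noteq> Num s))) \<and>
     (\<forall>k1\<in>{1..K1}. \<forall>f\<in>{1..F}. \<forall>k2\<in>{1..K2}.
        Q0 f k1 = Star \<longrightarrow> Q k1 f k2 \<in> {Star} \<union> Num ` Sm k1) \<and>
     (\<forall>k1\<in>{1..K1}. \<forall>f\<in>{1..F}. \<forall>f'\<in>{1..F}. \<forall>ki\<in>{1..K2}. \<forall>kj\<in>{1..K2}. \<forall>s\<in>Sm k1.
        (f, ki) \<noteq> (f', kj) \<and> Q k1 f ki = Num s \<and> Q k1 f' kj = Num s \<longrightarrow>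
        f \<noteq> f' \<and> ki \<noteq> kj \<and> Q k1 f kj = Star \<and> Q k1 f' ki = Star) \<and>
     is_PDA K' F' Z' S B \<and>
     (\<forall>U. active_set K1 K2 K' U \<longrightarrow> (\<exists>z. row_listing K' F F' Q0 Q B U z))"

text \<open>A packet is an element of the finite type \<open>'a\<close>, which carries \<open>log 2 CARD('a)\<close> bits.
  A file is a family of \<open>P\<close> packets, a library a family of \<open>N\<close> files.\<close>

type_synonym 'a library = "nat \<Rightarrow> nat \<Rightarrow> 'a"

definition libraries :: "nat \<Rightarrow> nat \<Rightarrow> 'a library set" where
  "libraries N P = {1..N} \<rightarrow>\<^sub>E ({1..P} \<rightarrow>\<^sub>E UNIV)"

text \<open>A cache or a transmission is a labelled family of packets, given by the functions that
  compute them from the library. The set of labels does not depend on the library, so it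
  carries no information about the files.\<close>

type_synonym ('l, 'a) packets = "'l \<rightharpoonup> ('a library \<Rightarrow> 'a)"

definition content :: "('l, 'a) packets \<Rightarrow> 'a library \<Rightarrow> ('l \<rightharpoonup> 'a)" where
  "content c W = (\<lambda>l. map_option (\<lambda>e. e W) (c l))"

text \<open>The size, in units of a file of \<open>Bits\<close> bits.\<close>

definition size_in_files :: "nat \<Rightarrow> ('l, 'a::finite) packets \<Rightarrow> real" where
  "size_in_files Bits c = real (card (dom c)) * log 2 (real CARD('a)) / real Bits"

text \<open>The caches depend neither on the set \<open>U\<close> of active users nor on the demands \<open>d\<close>.\<close>

record ('c, 't, 'a) hotplug =
  subpacketization :: nat
  mirror_cache :: "nat \<Rightarrow> ('c, 'a) packets"
  user_cache :: "nat \<times> nat \<Rightarrow> ('c, 'a) packets"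
  server_msg :: "(nat \<times> nat) set \<Rightarrow> (nat \<Rightarrow> nat) \<Rightarrow> ('t, 'a) packets"
  mirror_msg :: "(nat \<times> nat) set \<Rightarrow> (nat \<Rightarrow> nat) \<Rightarrow> nat \<Rightarrow> ('t, 'a) packets"

definition hotplug_scheme :: "nat \<Rightarrow> nat \<Rightarrow> nat \<Rightarrow> nat \<Rightarrow> real \<Rightarrow> real \<Rightarrow> nat \<Rightarrow>
    ('c, 't, 'a::finite) hotplug \<Rightarrow> bool" where
  "hotplug_scheme Bits K1 K2 K' M1 M2 N sch \<longleftrightarrow>
     real Bits = real (subpacketization sch) * log 2 (real CARD('a)) \<and>
     (\<forall>k1\<in>{1..K1}. finite (dom (mirror_cache sch k1)) \<and>
        size_in_files Bits (mirror_cache sch k1) = M1) \<and>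
     (\<forall>u\<in>{1..K1} \<times> {1..K2}. finite (dom (user_cache sch u)) \<and>
        size_in_files Bits (user_cache sch u) = M2) \<and>
     (\<forall>U d. active_set K1 K2 K' U \<and> d \<in> {1..K'} \<rightarrow> {1..N} \<longrightarrow>
        finite (dom (server_msg sch U d)) \<and>
        (\<forall>k1\<in>{1..K1}. finite (dom (mirror_msg sch U d k1))) \<and>
        (\<forall>u\<in>U. \<exists>decode. \<forall>W\<in>libraries N (subpacketization sch).
           decode (content (mirror_msg sch U d (fst u)) W) (content (user_cache sch u) W)
             = W (d (lex_pos U u))))"

text \<open>The packet with label \<open>l\<close> in the transmission of mirror \<open>k1\<close> is a function of what the
  mirror holds: the transmission of the server and its own cache. This is not a clause of
  \<open>hotplug_scheme\<close> since \<open>is_HHPDA\<close> allows integers of \<open>Q k1\<close> in rows that mirror \<open>k1\<close>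
  does not cache, and then the mirror need not be able to form the corresponding packets.\<close>

definition mirror_can_form :: "nat \<Rightarrow> ('c, 't, 'a) hotplug \<Rightarrow> (nat \<times> nat) set \<Rightarrow>
    (nat \<Rightarrow> nat) \<Rightarrow> nat \<Rightarrow> 't \<Rightarrow> bool" where
  "mirror_can_form N sch U d k1 l \<longleftrightarrow>
     (\<exists>form. \<forall>W\<in>libraries N (subpacketization sch).
        content (mirror_msg sch U d k1) W l
          = form (content (server_msg sch U d) W) (content (mirror_cache sch k1) W))"

definition server_load :: "nat \<Rightarrow> ('c, 't, 'a::finite) hotplug \<Rightarrow>
    (nat \<times> nat) set \<Rightarrow> (nat \<Rightarrow> nat) \<Rightarrow> real" where
  "server_load Bits sch U d = size_in_files Bits (server_msg sch U d)"

definition mirror_load :: "nat \<Rightarrow> nat \<Rightarrow> ('c, 't, 'a::finite) hotplug \<Rightarrow>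
    (nat \<times> nat) set \<Rightarrow> (nat \<Rightarrow> nat) \<Rightarrow> real" where
  "mirror_load Bits K1 sch U d = Max ((\<lambda>k1. size_in_files Bits (mirror_msg sch U d k1)) ` {1..K1})"

text \<open>\<open>G\<close> is an \<open>F' \<times> F\<close> matrix; \<open>encode F' G w\<close> is the transpose of \<open>G\<close> applied to \<open>w\<close>.\<close>

definition encode :: "nat \<Rightarrow> (nat \<Rightarrow> nat \<Rightarrow> 'a::field) \<Rightarrow> (nat \<Rightarrow> 'a) \<Rightarrow> nat \<Rightarrow> 'a" where
  "encode F' G w f = (\<Sum>i=1..F'. G i f * w i)"

definition hamming_dist :: "nat \<Rightarrow> (nat \<Rightarrow> 'a) \<Rightarrow> (nat \<Rightarrow> 'a) \<Rightarrow> nat" where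
  "hamming_dist F x y = card {f\<in>{1..F}. x f \<noteq> y f}"

text \<open>The code has dimension \<open>F'\<close>, and its minimum distance attains the Singleton bound.\<close>

definition mds_generator :: "nat \<Rightarrow> nat \<Rightarrow> (nat \<Rightarrow> nat \<Rightarrow> 'a::field) \<Rightarrow> bool" where
  "mds_generator F F' G \<longleftrightarrow>
     (let C = (\<lambda>w. restrict (encode F' G w) {1..F}) in
        inj_on C ({1..F'} \<rightarrow>\<^sub>E UNIV) \<and>
        Inf {hamming_dist F x y | x y.
          x \<in> C ` ({1..F'} \<rightarrow>\<^sub>E UNIV) \<and> y \<in> C ` ({1..F'} \<rightarrow>\<^sub>E UNIV) \<and> x \<noteq> y} = F - F' + 1)"

text \<open>The array \<open>Q'\<close> restricted to the rows listed by \<open>z\<close>, filled so that it equals \<open>B\<close>; it is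
  indexed by the elements of \<open>\<zeta> = z ` {1..F'}\<close> rather than by their positions.\<close>

definition filled :: "nat \<Rightarrow> (nat \<Rightarrow> nat \<Rightarrow> entry) \<Rightarrow> (nat \<Rightarrow> nat) \<Rightarrow> nat \<Rightarrow> nat \<Rightarrow> entry" where
  "filled F' B z f k = B (inv_into {1..F'} z f) k"

definition column_ints :: "nat set \<Rightarrow> (nat \<Rightarrow> nat \<Rightarrow> entry) \<Rightarrow> nat \<Rightarrow> int set" where
  "column_ints rows A k = {s. \<exists>f\<in>rows. A f k = Num s}"

text \<open>Mirror \<open>k1\<close> transmits a \<open>relay_packet\<close> for each of its \<open>server_ints\<close> and a
  \<open>local_packet\<close> for each of its \<open>mirror_ints\<close>; the two sets are disjoint in an HHPDA.\<close>

definition server_ints :: "nat \<Rightarrow> nat \<Rightarrow> (nat \<Rightarrow> nat \<Rightarrow> entry) \<Rightarrow> (nat \<times> nat) set \<Rightarrow> nat \<Rightarrow> int set" where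
  "server_ints K' F' B U k1 =
     (\<Union>j\<in>{j\<in>{1..K'}. nth_user U j \<in> users_of U k1}. column_ints {1..F'} B j)"

definition mirror_ints :: "nat \<Rightarrow> (nat \<Rightarrow> nat \<Rightarrow> nat \<Rightarrow> entry) \<Rightarrow> nat set \<Rightarrow>
    (nat \<times> nat) set \<Rightarrow> nat \<Rightarrow> int set" where
  "mirror_ints K2 Q \<zeta> U k1 =
     (\<Union>k2\<in>{k2\<in>{1..K2}. (k1, k2) \<in> users_of U k1}. column_ints \<zeta> (Q k1) k2)"

text \<open>Addition of packets is the addition of the field; over a field with \<open>2 ^ m\<close> elements it is
  the bitwise exclusive or of \<open>m\<close>-bit strings.\<close>

definition server_packet :: "nat \<Rightarrow> nat \<Rightarrow> (nat \<Rightarrow> nat \<Rightarrow> entry) \<Rightarrow> (nat \<Rightarrow> nat \<Rightarrow> 'a::field) \<Rightarrow>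
    (nat \<Rightarrow> nat) \<Rightarrow> (nat \<Rightarrow> nat) \<Rightarrow> int \<Rightarrow> 'a library \<Rightarrow> 'a" where
  "server_packet K' F' B G z d s W =
     (\<Sum>(f, k) \<in> {(f, k). f \<in> z ` {1..F'} \<and> k \<in> {1..K'} \<and> filled F' B z f k = Num s}.
        encode F' G (W (d k)) f)"

definition relay_packet :: "nat \<Rightarrow> nat \<Rightarrow> (nat \<Rightarrow> nat \<Rightarrow> entry) \<Rightarrow> (nat \<Rightarrow> nat \<Rightarrow> entry) \<Rightarrow>
    (nat \<Rightarrow> nat \<Rightarrow> 'a::field) \<Rightarrow> (nat \<Rightarrow> nat) \<Rightarrow> (nat \<times> nat) set \<Rightarrow> (nat \<Rightarrow> nat) \<Rightarrow>
    nat \<Rightarrow> int \<Rightarrow> 'a library \<Rightarrow> 'a" where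
  "relay_packet K' F' Q0 B G z U d k1 s W =
     server_packet K' F' B G z d s W +
     (\<Sum>(f, k) \<in> {(f, k). f \<in> z ` {1..F'} \<and> k \<in> {1..K'} - lex_pos U ` users_of U k1 \<and>
                    Q0 f k1 = Star \<and> filled F' B z f k = Num s}.
        encode F' G (W (d k)) f)"

definition local_packet :: "nat \<Rightarrow> (nat \<Rightarrow> nat \<Rightarrow> nat \<Rightarrow> entry) \<Rightarrow> (nat \<Rightarrow> nat \<Rightarrow> 'a::field) \<Rightarrow>
    (nat \<Rightarrow> nat) \<Rightarrow> (nat \<times> nat) set \<Rightarrow> (nat \<Rightarrow> nat) \<Rightarrow> nat \<Rightarrow> int \<Rightarrow> 'a library \<Rightarrow> 'a" where
  "local_packet F' Q G z U d k1 s W =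
     (\<Sum>(f, k2) \<in> {(f, k2). f \<in> z ` {1..F'} \<and> (k1, k2) \<in> users_of U k1 \<and> Q k1 f k2 = Num s}.
        encode F' G (W (d (lex_pos U (k1, k2)))) f)"

text \<open>\<open>z U\<close> is the listing of rows chosen for the active users \<open>U\<close>. A cached packet has
  label \<open>(n, f)\<close>; a transmitted packet is labelled by its integer.\<close>

definition algorithm :: "nat \<Rightarrow> nat \<Rightarrow> nat \<Rightarrow> nat \<Rightarrow> int set \<Rightarrow> (nat \<Rightarrow> nat \<Rightarrow> entry) \<Rightarrow>
    (nat \<Rightarrow> nat \<Rightarrow> nat \<Rightarrow> entry) \<Rightarrow> (nat \<Rightarrow> nat \<Rightarrow> entry) \<Rightarrow> (nat \<Rightarrow> nat \<Rightarrow> 'a::field) \<Rightarrow> nat \<Rightarrow>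
    ((nat \<times> nat) set \<Rightarrow> nat \<Rightarrow> nat) \<Rightarrow> (nat \<times> nat, int, 'a) hotplug" where
  "algorithm K2 K' F F' S Q0 Q B G N z =
     \<lparr>subpacketization = F',
      mirror_cache = (\<lambda>k1 (n, f).
        if n \<in> {1..N} \<and> f \<in> {1..F} \<and> Q0 f k1 = Star
        then Some (\<lambda>W. encode F' G (W n) f) else None),
      user_cache = (\<lambda>(k1, k2) (n, f).
        if n \<in> {1..N} \<and> f \<in> {1..F} \<and> Q k1 f k2 = Star
        then Some (\<lambda>W. encode F' G (W n) f) else None),
      server_msg = (\<lambda>U d s.
        if s \<in> S then Some (server_packet K' F' B G (z U) d s) else None),
      mirror_msg = (\<lambda>U d k1 s.
        if s \<in> server_ints K' F' B U k1
        then Some (relay_packet K' F' Q0 B G (z U) U d k1 s)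
        else if s \<in> mirror_ints K2 Q (z U ` {1..F'}) U k1
        then Some (local_packet F' Q G (z U) U d k1 s) else None)\<rparr>"

end

theory Submission
  imports Defs
begin

text \<open>An active user has cached every summand of the packets that it uses except the wanted one.
  For a local packet this is (A4). For a relay packet, (C3) makes each other summand a star of the
  merged array in the user's column. If it is not a star of the user, it is a star of the mirror;
  then it does not belong to a user of the same mirror, and so the mirror has removed it. Thus the
  user learns \<open>F'\<close> coordinates of a codeword, and two codewords agreeing there would be closer than
  the minimum distance.\<close>

section \<open>Characteristic 2, lexicographic ranks, MDS codes and decoders as
  factorizations\<close>

text \<open>Translation by 1 permutes the field, so adding \<open>CARD('a)\<close> copies of 1
  leaves the sum of all elements unchanged. Hence \<open>2 ^ m = 0\<close>, and a field has no
  nilpotent element other than 0.\<close>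

lemma double_eq_0_if_card_power_2:
  fixes x :: "'a::{finite, field}"
  assumes "CARD('a) = 2 ^ m"
  shows "x + x = 0"
proof -
  have "(\<Sum>y\<in>UNIV. y + (1::'a)) = (\<Sum>y\<in>UNIV. y)"
    by (rule sum.reindex_bij_witness[of _ "\<lambda>y. y - 1" "\<lambda>y. y + 1"]) auto
  hence "(of_nat CARD('a) :: 'a) = 0" by (simp add: sum.distrib)
  hence "(2::'a) ^ m = 0" by (simp add: assms)
  hence "(2::'a) = 0" by simp
  thus ?thesis by (metis mult_2 mult_zero_left)
qed

text \<open>The lexicographic order is a strict linear order, so a smaller user has fewer
  predecessors and ranks are injective. A user does not precede itself, which leaves at most
  \<open>card U - 1\<close> predecessors; with the \<open>Suc\<close> in \<open>lex_pos\<close> the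
  rank lies in \<open>{1..card U}\<close>, and counting gives surjectivity.\<close>

lemma bij_betw_lex_pos:
  assumes "finite U"
  shows "bij_betw (lex_pos U) U {1..card U}"
proof -
  let ?R = "less_than <*lex*> less_than"
  have mono: "lex_pos U u < lex_pos U v" if "u \<in> U" "(u, v) \<in> ?R" for u v
  proof -
    have "{w \<in> U. (w, u) \<in> ?R} \<subset> {w \<in> U. (w, v) \<in> ?R}"
      using that by (cases u; cases v) (auto simp: psubset_eq set_eq_iff)
    thus ?thesis using assms by (auto simp: lex_pos_def intro!: psubset_card_mono)
  qed
  have "inj_on (lex_pos U) U"
  proof (rule inj_onI, rule ccontr)
    fix u v assume "u \<in> U" "v \<in> U" "lex_pos U u = lex_pos U v" "u \<noteq> v"
    moreover from \<open>u \<noteq> v\<close> have "(u, v) \<in> ?R \<or> (v, u) \<in> ?R"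
      by (cases u; cases v) auto
    ultimately show False using mono by fastforce
  qed
  moreover have "lex_pos U ` U \<subseteq> {1..card U}"
  proof safe
    fix a b assume u: "(a, b) \<in> U"
    have "{w \<in> U. (w, (a, b)) \<in> ?R} \<subset> U"
      using u by (auto simp: psubset_eq set_eq_iff)
    hence "card {w \<in> U. (w, (a, b)) \<in> ?R} < card U" using assms by (simp add: psubset_card_mono)
    thus "lex_pos U (a, b) \<in> {1..card U}" by (simp add: lex_pos_def)
  qed
  ultimately show ?thesis
    by (simp add: bij_betw_def card_image card_subset_eq)
qed

text \<open>Erasure decoding. Distinct messages have distinct codewords, whose distance belongs to
  the set with infimum \<open>F - F' + 1\<close>; agreement on \<zeta> leaves only
  \<open>F - F'\<close> positions in which they can differ.\<close>

lemma mds_generator_determines: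
  assumes "mds_generator F F' G" "\<zeta> \<subseteq> {1..F}" "card \<zeta> = F'"
    and w: "w \<in> {1..F'} \<rightarrow>\<^sub>E UNIV" "w' \<in> {1..F'} \<rightarrow>\<^sub>E UNIV"
    and agree: "\<And>f. f \<in> \<zeta> \<Longrightarrow> encode F' G w f = encode F' G w' f"
  shows "w = w'"
proof (rule ccontr)
  assume "w \<noteq> w'"
  define C where "C w = restrict (encode F' G w) {1..F}" for w
  let ?M = "{1..F'} \<rightarrow>\<^sub>E UNIV"
  let ?D = "{hamming_dist F x y | x y. x \<in> C ` ?M \<and> y \<in> C ` ?M \<and> x \<noteq> y}"
  have "inj_on C ?M" and Inf: "Inf ?D = F - F' + 1"
    using assms(1) by (auto simp: mds_generator_def C_def[abs_def] Let_def)
  hence "C w \<noteq> C w'" using w \<open>w \<noteq> w'\<close> by (auto dest: inj_onD)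
  hence "hamming_dist F (C w) (C w') \<in> ?D" using w by blast
  hence "F - F' + 1 \<le> hamming_dist F (C w) (C w')"
    unfolding Inf[symmetric] by (rule cInf_lower) simp
  also have "\<dots> \<le> card ({1..F} - \<zeta>)"
    unfolding hamming_dist_def using agree by (intro card_mono) (auto simp: C_def)
  also have "\<dots> = F - F'"
    using assms(2,3) by (simp add: card_Diff_subset finite_subset)
  finally show False by simp
qed

text \<open>Turns the existence of a decoder into an injectivity statement: a quantity can be
  computed from \<open>p x\<close> and \<open>q x\<close> once it is constant on their joint fibres.
  The witness evaluates \<open>h\<close> at a chosen point of the fibre. The users' decoders and the
  mirrors' encoders both arise in this way, with \<open>x\<close> ranging over libraries.\<close>

lemma ex_factor2:
  assumes "\<And>x y. x \<in> A \<Longrightarrow> y \<in> A \<Longrightarrow> p x = p y \<Longrightarrow> q x = q y \<Longrightarrow> h x = h y"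
  shows "\<exists>g. \<forall>x\<in>A. g (p x) (q x) = h x"
proof -
  have "h (SOME y. y \<in> A \<and> p y = p x \<and> q y = q x) = h x" if "x \<in> A" for x
    using someI[of "\<lambda>y. y \<in> A \<and> p y = p x \<and> q y = q x" x] that assms by metis
  thus ?thesis
    by (intro exI[of _ "\<lambda>a b. h (SOME y. y \<in> A \<and> p y = a \<and> q y = b)"]) simp
qed

text \<open>The cancellation step of decoding: \<open>g\<close> and \<open>h\<close> will be the
  summands of one transmitted packet for two libraries that the receiver cannot tell apart, and
  \<open>a\<close> the index of the wanted summand.\<close>

lemma sum_eq_imp_summand_eq:
  fixes g h :: "'b \<Rightarrow> 'a::ab_group_add"
  assumes "finite A" "a \<in> A" "sum g A = sum h A"
    and "\<And>x. x \<in> A \<Longrightarrow> x \<noteq> a \<Longrightarrow> g x = h x"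
  shows "g a = h a"
proof -
  have "sum g (A - {a}) = sum h (A - {a})"
    using assms(4) by (intro sum.cong) auto
  thus ?thesis using assms(1-3) by (simp add: sum.remove)
qed

section \<open>The clauses of the array definitions as separate facts\<close>

lemma
  assumes "is_PDA K F Z T P"
  shows is_PDA_entry: "\<forall>j\<in>{1..F}. \<forall>k\<in>{1..K}. P j k \<in> {Star} \<union> Num ` T"
    and is_PDA_occurs: "\<forall>s\<in>T. \<exists>j\<in>{1..F}. \<exists>k\<in>{1..K}. P j k = Num s"
    and is_PDA_repeated:
      "\<forall>j1\<in>{1..F}. \<forall>j2\<in>{1..F}. \<forall>k1\<in>{1..K}. \<forall>k2\<in>{1..K}. \<forall>s.
         (j1, k1) \<noteq> (j2, k2) \<and> P j1 k1 = Num s \<and> P j2 k2 = Num s \<longrightarrow>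
         j1 \<noteq> j2 \<and> k1 \<noteq> k2 \<and> P j1 k2 = Star \<and> P j2 k1 = Star"
  using assms unfolding is_PDA_def by - (elim conjE, assumption)+

lemma
  assumes "is_HHPDA K1 K2 K' F F' Z1 Z2 Z' S Sm Q0 Q B"
  shows is_HHPDA_pos: "0 < K1" "0 < F'"
    and is_HHPDA_ints_disjoint: "\<forall>k1\<in>{1..K1}. S \<inter> Sm k1 = {}"
    and is_HHPDA_user_entry:
      "\<forall>k1\<in>{1..K1}. \<forall>f\<in>{1..F}. \<forall>k2\<in>{1..K2}. Q k1 f k2 \<in> {Star, Null} \<union> Num ` Sm k1"
    and is_HHPDA_mirror_stars: "\<forall>k1\<in>{1..K1}. card {f\<in>{1..F}. Q0 f k1 = Star} = Z1"
    and is_HHPDA_user_stars: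
      "\<forall>k1\<in>{1..K1}. \<forall>k2\<in>{1..K2}. card {f\<in>{1..F}. Q k1 f k2 = Star} = Z2"
    and is_HHPDA_below_mirror_star:
      "\<forall>k1\<in>{1..K1}. \<forall>f\<in>{1..F}. \<forall>k2\<in>{1..K2}.
         Q0 f k1 = Star \<longrightarrow> Q k1 f k2 \<in> {Star} \<union> Num ` Sm k1"
    and is_HHPDA_repeated:
      "\<forall>k1\<in>{1..K1}. \<forall>f\<in>{1..F}. \<forall>f'\<in>{1..F}. \<forall>ki\<in>{1..K2}. \<forall>kj\<in>{1..K2}. \<forall>s\<in>Sm k1.
         (f, ki) \<noteq> (f', kj) \<and> Q k1 f ki = Num s \<and> Q k1 f' kj = Num s \<longrightarrow>
         f \<noteq> f' \<and> ki \<noteq> kj \<and> Q k1 f kj = Star \<and> Q k1 f' ki = Star"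
    and is_HHPDA_PDA: "is_PDA K' F' Z' S B"
    and is_HHPDA_ex_listing:
      "\<forall>U. active_set K1 K2 K' U \<longrightarrow> (\<exists>z. row_listing K' F F' Q0 Q B U z)"
  using assms unfolding is_HHPDA_def by - (elim conjE, assumption)+

lemma finite_column_ints:
  assumes "finite R"
  shows "finite (column_ints R A k)"
proof (rule finite_subset)
  \<comment> \<open>The value 0 at entries that are not integers is a dummy; only inclusion in a
    finite image is claimed.\<close>
  show "column_ints R A k \<subseteq> (\<lambda>f. case A f k of Num s \<Rightarrow> s | _ \<Rightarrow> 0) ` R"
    by (force simp: column_ints_def)
qed (simp add: assms)

section \<open>A single delivery: ranks, rows, stars and integers\<close>

text \<open>Here \<open>z\<close> lists the rows for this \<open>U\<close> alone, while
  \<open>algorithm\<close> takes a listing for every set of users. Where the two must match, the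
  lemmas on \<open>algorithm\<close> assume \<open>y U = z\<close> for its family
  \<open>y\<close>.\<close>

locale hhpda_delivery =
  fixes K1 K2 K' F F' Z1 Z2 Z' N :: nat
    and S :: "int set" and Sm :: "nat \<Rightarrow> int set"
    and Q0 B :: "nat \<Rightarrow> nat \<Rightarrow> entry" and Q :: "nat \<Rightarrow> nat \<Rightarrow> nat \<Rightarrow> entry"
    and U :: "(nat \<times> nat) set" and z d :: "nat \<Rightarrow> nat"
  assumes hhpda: "is_HHPDA K1 K2 K' F F' Z1 Z2 Z' S Sm Q0 Q B"
    and active: "active_set K1 K2 K' U"
    and listing: "row_listing K' F F' Q0 Q B U z"
    and demands: "d \<in> {1..K'} \<rightarrow> {1..N}"
begin

lemma active_users: "U \<subseteq> {1..K1} \<times> {1..K2}" "finite U" "card U = K'"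
  using active finite_subset by (auto simp: active_set_def)

lemma lex_pos_bij: "bij_betw (lex_pos U) U {1..K'}"
  using bij_betw_lex_pos active_users by metis

lemma lex_pos_range: "u \<in> U \<Longrightarrow> lex_pos U u \<in> {1..K'}"
  using lex_pos_bij by (auto simp: bij_betw_def)

lemma nth_user_lex_pos [simp]: "u \<in> U \<Longrightarrow> nth_user U (lex_pos U u) = u"
  using lex_pos_bij by (simp add: nth_user_def bij_betw_def)

lemma nth_user_in: "k \<in> {1..K'} \<Longrightarrow> nth_user U k \<in> U"
  and lex_pos_nth_user [simp]: "k \<in> {1..K'} \<Longrightarrow> lex_pos U (nth_user U k) = k"
  using lex_pos_bij by (auto simp: nth_user_def bij_betw_def inv_into_into f_inv_into_f)

lemma rows: "bij_betw z {1..F'} (z ` {1..F'})" "z ` {1..F'} \<subseteq> {1..F}" "card (z ` {1..F'}) = F'"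
  using listing by (auto simp: row_listing_def bij_betw_def)

lemma row_in: "i \<in> {1..F'} \<Longrightarrow> z i \<in> {1..F}"
  using rows(2) by blast

lemma filled_row [simp]: "i \<in> {1..F'} \<Longrightarrow> filled F' B z (z i) k = B i k"
  using rows(1) by (simp add: filled_def bij_betw_def)

text \<open>The bridge between \<open>B\<close> and the caches. A star of \<open>B\<close> does not
  tell whether the mirror or the user holds the packets of that row, and decoding has to treat the
  two cases differently.\<close>

lemma star_iff:
  assumes "i \<in> {1..F'}" "k \<in> {1..K'}" "nth_user U k = (k1, k2)"
  shows "B i k = Star \<longleftrightarrow> Q0 (z i) k1 = Star \<or> Q k1 (z i) k2 = Star"
proof -
  have "merged Q0 Q (z i) (nth_user U k) = Star \<longleftrightarrow> B i k = Star"
    using listing assms(1,2) by (simp add: row_listing_def)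
  thus ?thesis by (auto simp: merged_def assms(3) split: if_splits)
qed

lemma pda: "is_PDA K' F' Z' S B"
  using hhpda by (rule is_HHPDA_PDA)

lemma B_entry: "i \<in> {1..F'} \<Longrightarrow> k \<in> {1..K'} \<Longrightarrow> B i k \<in> {Star} \<union> Num ` S"
  using is_PDA_entry[OF pda] by blast

text \<open>The corner of the square in (C3) that decoding uses: if \<open>(i, k)\<close> is the
  wanted entry and \<open>(i', k')\<close> an interfering one, the star is in the wanted column and
  the interfering row. \<open>Q_repeated\<close> extracts the same corner from (A4).\<close>

lemma B_repeated:
  assumes "i \<in> {1..F'}" "k \<in> {1..K'}" "i' \<in> {1..F'}" "k' \<in> {1..K'}"
    and "B i k = Num s" "B i' k' = Num s" "(i', k') \<noteq> (i, k)"
  shows "B i' k = Star"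
  using is_PDA_repeated[OF pda] assms by blast

lemma Q_num:
  assumes "k1 \<in> {1..K1}" "f \<in> {1..F}" "k2 \<in> {1..K2}" "Q k1 f k2 = Num s"
  shows "s \<in> Sm k1"
proof -
  have "Q k1 f k2 \<in> {Star, Null} \<union> Num ` Sm k1"
    using is_HHPDA_user_entry[OF hhpda] assms(1-3) by blast
  thus ?thesis using assms(4) by auto
qed

lemma Q_below_mirror_star:
  assumes "k1 \<in> {1..K1}" "f \<in> {1..F}" "k2 \<in> {1..K2}" "Q0 f k1 = Star"
  shows "Q k1 f k2 \<in> {Star} \<union> Num ` Sm k1"
  using is_HHPDA_below_mirror_star[OF hhpda] assms by blast

lemma Q_repeated:
  assumes "k1 \<in> {1..K1}" "f \<in> {1..F}" "k2 \<in> {1..K2}" "f' \<in> {1..F}" "k2' \<in> {1..K2}"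
    and "Q k1 f k2 = Num s" "Q k1 f' k2' = Num s" "(f', k2') \<noteq> (f, k2)"
  shows "Q k1 f' k2 = Star"
proof -
  have "s \<in> Sm k1" using Q_num assms by blast
  thus ?thesis using is_HHPDA_repeated[OF hhpda] assms by blast
qed

lemma server_ints_subset: "server_ints K' F' B U k1 \<subseteq> S"
  using B_entry by (fastforce simp: server_ints_def column_ints_def)

lemma mirror_ints_subset:
  assumes "k1 \<in> {1..K1}"
  shows "mirror_ints K2 Q (z ` {1..F'}) U k1 \<subseteq> Sm k1"
  using assms rows(2) by (fastforce simp: mirror_ints_def column_ints_def intro: Q_num)

text \<open>Serves two purposes: a local integer does reach the second branch of
  \<open>mirror_msg\<close> in \<open>algorithm\<close>, and the size of the mirror's transmission
  is the sum of the two counts.\<close>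

lemma ints_disjoint:
  assumes "k1 \<in> {1..K1}"
  shows "server_ints K' F' B U k1 \<inter> mirror_ints K2 Q (z ` {1..F'}) U k1 = {}"
proof -
  have "S \<inter> Sm k1 = {}" using is_HHPDA_ints_disjoint[OF hhpda] assms by blast
  thus ?thesis using server_ints_subset mirror_ints_subset[OF assms] by blast
qed

lemma finite_S: "finite S"
proof -
  have "S \<subseteq> (\<Union>k\<in>{1..K'}. column_ints {1..F'} B k)"
    using is_PDA_occurs[OF pda] by (fastforce simp: column_ints_def)
  thus ?thesis by (rule finite_subset) (simp add: finite_column_ints)
qed

lemma finite_mirror_ints: "finite (mirror_ints K2 Q (z ` {1..F'}) U k1)"
  by (simp add: mirror_ints_def finite_column_ints)

text \<open>The mirror's second sum is a subsum of the server's packet, so in characteristic 2 adding it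
  deletes those summands.\<close>

lemma relay_packet_eq:
  fixes G :: "nat \<Rightarrow> nat \<Rightarrow> 'a::field"
  assumes "\<And>x::'a. x + x = 0"
  shows "relay_packet K' F' Q0 B G z U d k1 s W =
    (\<Sum>(i, k) \<in> {(i, k). i \<in> {1..F'} \<and> k \<in> {1..K'} \<and> B i k = Num s \<and>
                   (fst (nth_user U k) = k1 \<or> Q0 (z i) k1 \<noteq> Star)}.
       encode F' G (W (d k)) (z i))"
proof -
  define own where "own = lex_pos U ` users_of U k1"
  let ?all = "{(f, k). f \<in> z ` {1..F'} \<and> k \<in> {1..K'} \<and> filled F' B z f k = Num s}"
  let ?del = "{(f, k). f \<in> z ` {1..F'} \<and> k \<in> {1..K'} - own \<and>
                 Q0 f k1 = Star \<and> filled F' B z f k = Num s}"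
  let ?rest = "{(i, k). i \<in> {1..F'} \<and> k \<in> {1..K'} \<and> B i k = Num s \<and>
                   (fst (nth_user U k) = k1 \<or> Q0 (z i) k1 \<noteq> Star)}"
  let ?e = "\<lambda>(f, k). encode F' G (W (d k)) f"
  have fin: "finite ?all"
    by (rule finite_subset[of _ "z ` {1..F'} \<times> {1..K'}"]) auto
  have own: "k \<in> own \<longleftrightarrow> fst (nth_user U k) = k1" if "k \<in> {1..K'}" for k
  proof
    assume "fst (nth_user U k) = k1"
    hence "nth_user U k \<in> users_of U k1" using nth_user_in[OF that] by (simp add: users_of_def)
    thus "k \<in> own" using lex_pos_nth_user[OF that] unfolding own_def by (metis image_eqI)
  qed (auto simp: own_def users_of_def)
  have "relay_packet K' F' Q0 B G z U d k1 s W = sum ?e ?all + sum ?e ?del"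
    by (simp add: relay_packet_def server_packet_def own_def)
  also have "sum ?e ?all = sum ?e (?all - ?del) + sum ?e ?del"
    using fin by (intro sum.subset_diff) auto
  also have "\<dots> + sum ?e ?del = sum ?e (?all - ?del)"
    by (simp add: assms add.assoc)
  \<comment> \<open>Rows are renamed by their positions in the listing: \<open>z\<close> is
    injective on \<open>{1..F'}\<close>, and row \<open>z i\<close> of the filled array is row
    \<open>i\<close> of \<open>B\<close>.\<close>
  also have "\<dots> = (\<Sum>(i, k)\<in>?rest. encode F' G (W (d k)) (z i))"
    by (rule sum.reindex_bij_witness
        [of _ "\<lambda>(i, k). (z i, k)" "\<lambda>(f, k). (inv_into {1..F'} z f, k)"])
      (use bij_betw_inv_into_left[OF rows(1)] own in auto)
  finally show ?thesis .
qed

section \<open>Recovery of the demanded files\<close>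

text \<open>Knowledge is expressed by comparing two libraries, as \<open>ex_factor2\<close>
  requires: a coded packet is known to the mirror if equal cache contents force equal values of
  it.\<close>

lemma content_mirror_cache_eqD:
  assumes "content (mirror_cache (algorithm K2 K' F F' S Q0 Q B G N y) k1) W =
      content (mirror_cache (algorithm K2 K' F F' S Q0 Q B G N y) k1) W'"
    and "n \<in> {1..N}" "f \<in> {1..F}" "Q0 f k1 = Star"
  shows "encode F' G (W n) f = encode F' G (W' n) f"
  using fun_cong[OF assms(1), of "(n, f)"] assms(2-) by (simp add: content_def algorithm_def)

lemma content_user_cache_eqD:
  assumes "content (user_cache (algorithm K2 K' F F' S Q0 Q B G N y) (k1, k2)) W =
      content (user_cache (algorithm K2 K' F F' S Q0 Q B G N y) (k1, k2)) W'"
    and "n \<in> {1..N}" "f \<in> {1..F}" "Q k1 f k2 = Star"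
  shows "encode F' G (W n) f = encode F' G (W' n) f"
  using fun_cong[OF assms(1), of "(n, f)"] assms(2-) by (simp add: content_def algorithm_def)

lemma demand_in: "k \<in> {1..K'} \<Longrightarrow> d k \<in> {1..N}"
  using demands by blast

lemma local_packet_recovers:
  assumes u: "(k1, k2) \<in> U" and i: "i \<in> {1..F'}" and s: "Q k1 (z i) k2 = Num s"
    and packet: "local_packet F' Q G z U d k1 s W = local_packet F' Q G z U d k1 s W'"
    and cache: "\<And>n f. n \<in> {1..N} \<Longrightarrow> f \<in> {1..F} \<Longrightarrow> Q k1 f k2 = Star \<Longrightarrow>
        encode F' G (W n) f = encode F' G (W' n) f"
  shows "encode F' G (W (d (lex_pos U (k1, k2)))) (z i) =
    encode F' G (W' (d (lex_pos U (k1, k2)))) (z i)"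
proof -
  \<comment> \<open>The bound \<open>k2\<close>, here and in \<open>?e\<close>, shadows the user's
    own \<open>k2\<close>: the sum runs over all active users of mirror \<open>k1\<close>.\<close>
  let ?A = "{(f, k2). f \<in> z ` {1..F'} \<and> (k1, k2) \<in> users_of U k1 \<and> Q k1 f k2 = Num s}"
  let ?e = "\<lambda>W (f, k2). encode F' G (W (d (lex_pos U (k1, k2)))) f"
  have "finite ?A"
    by (rule finite_subset[of _ "z ` {1..F'} \<times> snd ` U"])
      (use active_users(2) in \<open>force simp: users_of_def\<close>)+
  moreover have "(z i, k2) \<in> ?A" using u i s by (auto simp: users_of_def)
  moreover have "sum (?e W) ?A = sum (?e W') ?A"
    using packet by (simp add: local_packet_def)
  moreover have "?e W x = ?e W' x" if x: "x \<in> ?A" "x \<noteq> (z i, k2)" for x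
  proof -
    obtain f k2' where [simp]: "x = (f, k2')" by fastforce
    have f: "f \<in> {1..F}" "(k1, k2') \<in> U" "Q k1 f k2' = Num s"
      using x rows(2) by (auto simp: users_of_def)
    have "k1 \<in> {1..K1}" "k2 \<in> {1..K2}" "k2' \<in> {1..K2}"
      using u f(2) active_users(1) by auto
    \<comment> \<open>This is (A4), with the wanted entry \<open>(z i, k2)\<close> as the other
      occurrence of \<open>s\<close>; the interfering packet is thus in the user's own
      cache.\<close>
    hence "Q k1 f k2 = Star"
      using Q_repeated[of k1 "z i" k2 f k2' s] f s x(2) row_in[OF i] by simp
    thus ?thesis using cache[OF demand_in[OF lex_pos_range[OF f(2)]] f(1)] by simp
  qed
  ultimately have "?e W (z i, k2) = ?e W' (z i, k2)"
    by (rule sum_eq_imp_summand_eq)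
  thus ?thesis by simp
qed

text \<open>Works with the reduced form of \<open>relay_packet_eq\<close>, whose surviving summands
  belong to users of mirror \<open>k1\<close> or to rows that this mirror does not cache. In both
  cases the star that (C3) provides must be the user's own.\<close>

lemma relay_packet_recovers:
  fixes G :: "nat \<Rightarrow> nat \<Rightarrow> 'a::field"
  assumes char2: "\<And>x::'a. x + x = 0"
    and u: "(k1, k2) \<in> U" and i: "i \<in> {1..F'}" and s: "B i (lex_pos U (k1, k2)) = Num s"
    and packet: "relay_packet K' F' Q0 B G z U d k1 s W = relay_packet K' F' Q0 B G z U d k1 s W'"
    and cache: "\<And>n f. n \<in> {1..N} \<Longrightarrow> f \<in> {1..F} \<Longrightarrow> Q k1 f k2 = Star \<Longrightarrow>
        encode F' G (W n) f = encode F' G (W' n) f"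
  shows "encode F' G (W (d (lex_pos U (k1, k2)))) (z i) =
    encode F' G (W' (d (lex_pos U (k1, k2)))) (z i)"
proof -
  let ?j = "lex_pos U (k1, k2)"
  let ?A = "{(i, k). i \<in> {1..F'} \<and> k \<in> {1..K'} \<and> B i k = Num s \<and>
                   (fst (nth_user U k) = k1 \<or> Q0 (z i) k1 \<noteq> Star)}"
  let ?e = "\<lambda>W (i, k). encode F' G (W (d k)) (z i)"
  have j: "?j \<in> {1..K'}" "nth_user U ?j = (k1, k2)" using lex_pos_range[OF u] u by simp_all
  have "finite ?A"
    by (rule finite_subset[of _ "{1..F'} \<times> {1..K'}"]) auto
  moreover have "(i, ?j) \<in> ?A" using i j s by simp
  moreover have "sum (?e W) ?A = sum (?e W') ?A"
    using packet by (simp add: relay_packet_eq[OF char2])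
  moreover have "?e W x = ?e W' x" if x: "x \<in> ?A" "x \<noteq> (i, ?j)" for x
  proof -
    obtain i' k where [simp]: "x = (i', k)" by fastforce
    have i': "i' \<in> {1..F'}" and k: "k \<in> {1..K'}" and s': "B i' k = Num s"
      and kept: "fst (nth_user U k) = k1 \<or> Q0 (z i') k1 \<noteq> Star"
      using x by auto
    have "B i' ?j = Star"
      using B_repeated[of i ?j i' k s] i j i' k s s' x by auto
    hence star: "Q0 (z i') k1 = Star \<or> Q k1 (z i') k2 = Star"
      using star_iff[OF i' j] by simp
    \<comment> \<open>If column \<open>k\<close> belongs to a user of mirror \<open>k1\<close>, a
      mirror star in this row would make \<open>B i' k\<close> a star, but it is an integer. For any
      other column the summand was kept precisely because the mirror does not cache the row.\<close>
    have "Q0 (z i') k1 \<noteq> Star"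
      using kept s' star_iff[OF i' k, of k1 "snd (nth_user U k)"]
      by (metis entry.distinct(3) prod.collapse)
    thus ?thesis using star cache[OF demand_in[OF k] row_in[OF i']] by simp
  qed
  ultimately have "?e W (i, ?j) = ?e W' (i, ?j)"
    by (rule sum_eq_imp_summand_eq)
  thus ?thesis by simp
qed

text \<open>By \<open>ex_factor2\<close> it suffices to compare two libraries with the same
  transmission and the same user cache. Each row of \<zeta> yields one coordinate of the demanded
  codeword: from the cache if the user has a star, from a local packet if only the mirror has one,
  and from a relay packet if neither has.\<close>

lemma user_decodes:
  fixes G :: "nat \<Rightarrow> nat \<Rightarrow> 'a::field"
  assumes char2: "\<And>x::'a. x + x = 0" and mds: "mds_generator F F' G"
    and y: "y U = z" and u: "u \<in> U"
  shows "\<exists>decode. \<forall>W\<in>libraries N F'.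
    decode (content (mirror_msg (algorithm K2 K' F F' S Q0 Q B G N y) U d (fst u)) W)
      (content (user_cache (algorithm K2 K' F F' S Q0 Q B G N y) u) W) = W (d (lex_pos U u))"
proof (rule ex_factor2)
  fix W W' :: "'a library"
  let ?sch = "algorithm K2 K' F F' S Q0 Q B G N y"
  obtain k1 k2 where [simp]: "u = (k1, k2)" by fastforce
  let ?j = "lex_pos U u"
  assume W: "W \<in> libraries N F'" "W' \<in> libraries N F'"
    and msg: "content (mirror_msg ?sch U d (fst u)) W = content (mirror_msg ?sch U d (fst u)) W'"
    and cch: "content (user_cache ?sch u) W = content (user_cache ?sch u) W'"
  have k: "k1 \<in> {1..K1}" "k2 \<in> {1..K2}" using active_users(1) u by auto
  have j: "?j \<in> {1..K'}" "nth_user U ?j = (k1, k2)"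
    using lex_pos_range[OF u] u by simp_all
  have own: "(k1, k2) \<in> users_of U k1" using u by (simp add: users_of_def)
  have cache: "encode F' G (W n) f = encode F' G (W' n) f"
    if "n \<in> {1..N}" "f \<in> {1..F}" "Q k1 f k2 = Star" for n f
    using content_user_cache_eqD[of G y k1 k2 W W' n f] cch that by simp
  have coords: "encode F' G (W (d ?j)) (z i) = encode F' G (W' (d ?j)) (z i)"
    if i: "i \<in> {1..F'}" for i
  proof -
    consider "Q k1 (z i) k2 = Star" | "Q0 (z i) k1 = Star" "Q k1 (z i) k2 \<noteq> Star"
      | "Q0 (z i) k1 \<noteq> Star" "Q k1 (z i) k2 \<noteq> Star" by blast
    thus ?thesis
    proof cases
      case 1
      thus ?thesis using cache demand_in[OF j(1)] row_in[OF i] by blast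
    next
      case 2
      \<comment> \<open>By the second half of (A3) an entry below a mirror star is never
        null.\<close>
      then obtain s where s: "Q k1 (z i) k2 = Num s"
        using Q_below_mirror_star[of k1 "z i" k2] k row_in[OF i] by auto
      hence s_in: "s \<in> mirror_ints K2 Q (z ` {1..F'}) U k1"
        using i k(2) own unfolding mirror_ints_def column_ints_def by blast
      have "s \<notin> server_ints K' F' B U k1"
        using s_in ints_disjoint[OF k(1)] by blast
      hence "local_packet F' Q G z U d k1 s W = local_packet F' Q G z U d k1 s W'"
        using fun_cong[OF msg, of s] s_in y by (simp add: content_def algorithm_def)
      thus ?thesis using local_packet_recovers[of k1 k2 i s G W W'] u i s cache by simp
    next
      case 3
      \<comment> \<open>With no star in either layer, \<open>B\<close> has no star here, hence an
        integer.\<close>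
      then obtain s where s: "B i ?j = Num s"
        using B_entry[OF i j(1)] star_iff[OF i j] by auto
      hence "s \<in> server_ints K' F' B U k1"
        using i j own by (fastforce simp: server_ints_def column_ints_def)
      hence "relay_packet K' F' Q0 B G z U d k1 s W = relay_packet K' F' Q0 B G z U d k1 s W'"
        using fun_cong[OF msg, of s] y by (simp add: content_def algorithm_def)
      thus ?thesis using relay_packet_recovers[OF char2, of k1 k2 i s G W W'] u i s cache by simp
    qed
  qed
  have "W (d ?j) \<in> {1..F'} \<rightarrow>\<^sub>E UNIV" "W' (d ?j) \<in> {1..F'} \<rightarrow>\<^sub>E UNIV"
    using W demand_in[OF j(1)] by (auto simp: libraries_def dest: PiE_mem)
  thus "W (d ?j) = W' (d ?j)"
    using mds_generator_determines[OF mds rows(2,3)] coords by blast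
qed

section \<open>What a mirror can form, and the sizes of caches and transmissions\<close>

text \<open>A relay packet is a packet of the server plus a sum restricted to rows that the mirror
  caches. For a local packet it is \<open>cached\<close> that places all its rows in the mirror's
  cache.\<close>

lemma mirror_forms:
  fixes G :: "nat \<Rightarrow> nat \<Rightarrow> 'a::field"
  assumes y: "y U = z" and k1: "k1 \<in> {1..K1}"
    and s: "s \<in> dom (mirror_msg (algorithm K2 K' F F' S Q0 Q B G N y) U d k1)"
    and cached: "\<forall>f\<in>z ` {1..F'}. \<forall>k2. (k1, k2) \<in> U \<and> Q k1 f k2 = Num s \<longrightarrow> Q0 f k1 = Star"
  shows "mirror_can_form N (algorithm K2 K' F F' S Q0 Q B G N y) U d k1 s"
proof -
  let ?sch = "algorithm K2 K' F F' S Q0 Q B G N y"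
  have "content (mirror_msg ?sch U d k1) W s = content (mirror_msg ?sch U d k1) W' s"
    if server: "content (server_msg ?sch U d) W = content (server_msg ?sch U d) W'"
      and mirror: "content (mirror_cache ?sch k1) W = content (mirror_cache ?sch k1) W'" for W W'
  proof -
    note cache = content_mirror_cache_eqD[OF mirror]
    have "relay_packet K' F' Q0 B G z U d k1 s W = relay_packet K' F' Q0 B G z U d k1 s W'"
      if "s \<in> server_ints K' F' B U k1"
    proof -
      have "s \<in> S" using that server_ints_subset by blast
      hence "server_packet K' F' B G z d s W = server_packet K' F' B G z d s W'"
        using fun_cong[OF server, of s] y by (simp add: content_def algorithm_def)
      thus ?thesis
        unfolding relay_packet_def using rows(2) demand_in
        by (intro arg_cong2[of _ _ _ _ "(+)"] sum.cong) (auto intro!: cache)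
    qed
    moreover have "local_packet F' Q G z U d k1 s W = local_packet F' Q G z U d k1 s W'"
      unfolding local_packet_def
    proof (intro sum.cong refl, clarify)
      fix i k2 assume "i \<in> {1..F'}" "(k1, k2) \<in> users_of U k1" "Q k1 (z i) k2 = Num s"
      thus "encode F' G (W (d (lex_pos U (k1, k2)))) (z i) =
          encode F' G (W' (d (lex_pos U (k1, k2)))) (z i)"
        using cached by (intro cache demand_in lex_pos_range row_in) (auto simp: users_of_def)
    qed
    ultimately show ?thesis using y by (simp add: content_def algorithm_def)
  qed
  hence "\<exists>form. \<forall>W\<in>libraries N (subpacketization ?sch).
      form (content (server_msg ?sch U d) W) (content (mirror_cache ?sch k1) W)
        = content (mirror_msg ?sch U d k1) W s"
    by (intro ex_factor2)
  thus ?thesis unfolding mirror_can_form_def by metis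
qed

lemma dom_server_msg: "dom (server_msg (algorithm K2 K' F F' S Q0 Q B G N y) U d) = S"
  by (auto simp: algorithm_def dom_def)

lemma dom_mirror_msg:
  assumes "y U = z"
  shows "dom (mirror_msg (algorithm K2 K' F F' S Q0 Q B G N y) U d k1) =
    server_ints K' F' B U k1 \<union> mirror_ints K2 Q (z ` {1..F'}) U k1"
  using assms by (auto simp: algorithm_def dom_def)

lemma finite_dom_mirror_msg:
  assumes "y U = z"
  shows "finite (dom (mirror_msg (algorithm K2 K' F F' S Q0 Q B G N y) U d k1))"
  unfolding dom_mirror_msg[where y = y, OF assms]
  using finite_subset[OF server_ints_subset finite_S] finite_mirror_ints by (rule finite_UnI)

lemma card_dom_mirror_msg:
  assumes "y U = z" "k1 \<in> {1..K1}"
  shows "card (dom (mirror_msg (algorithm K2 K' F F' S Q0 Q B G N y) U d k1)) =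
    card (server_ints K' F' B U k1) + card (mirror_ints K2 Q (z ` {1..F'}) U k1)"
  unfolding dom_mirror_msg[where y = y, OF assms(1)]
  using finite_subset[OF server_ints_subset finite_S] finite_mirror_ints ints_disjoint[OF assms(2)]
  by (rule card_Un_disjoint)

end

lemma dom_mirror_cache: "dom (mirror_cache (algorithm K2 K' F F' S Q0 Q B G N z) k1) =
    {1..N} \<times> {f \<in> {1..F}. Q0 f k1 = Star}"
  by (auto simp: algorithm_def dom_def split: if_splits)

lemma dom_user_cache: "dom (user_cache (algorithm K2 K' F F' S Q0 Q B G N z) (k1, k2)) =
    {1..N} \<times> {f \<in> {1..F}. Q k1 f k2 = Star}"
  by (auto simp: algorithm_def dom_def split: if_splits)


theorem theorem1:
  fixes K1 K2 K' F F' Z1 Z2 Z' N Bits m :: nat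
    and S :: "int set" and Sm :: "nat \<Rightarrow> int set"
    and Q0 B :: "nat \<Rightarrow> nat \<Rightarrow> entry" and Q :: "nat \<Rightarrow> nat \<Rightarrow> nat \<Rightarrow> entry"
    and G :: "nat \<Rightarrow> nat \<Rightarrow> 'a::{finite, field}"
  assumes "is_HHPDA K1 K2 K' F F' Z1 Z2 Z' S Sm Q0 Q B"
    and "0 < N"
    and "CARD('a) = 2 ^ m" and "Bits = F' * m"
    and "mds_generator F F' G"
  shows "(\<exists>z. \<forall>U. active_set K1 K2 K' U \<longrightarrow> row_listing K' F F' Q0 Q B U (z U)) \<and>
    (\<forall>z. (\<forall>U. active_set K1 K2 K' U \<longrightarrow> row_listing K' F F' Q0 Q B U (z U)) \<longrightarrow>
      (let sch = algorithm K2 K' F F' S Q0 Q B G N z in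
        (\<exists>M1 M2. hotplug_scheme Bits K1 K2 K' M1 M2 N sch \<and>
           M1 / real N = real Z1 / real F' \<and> M2 / real N = real Z2 / real F') \<and>
        subpacketization sch = F' \<and>
        (\<forall>U d. active_set K1 K2 K' U \<and> d \<in> {1..K'} \<rightarrow> {1..N} \<longrightarrow>
           server_load Bits sch U d = real (card S) / real F' \<and>
           mirror_load Bits K1 sch U d =
             1 / real F' * real (Max ((\<lambda>k1. card (server_ints K' F' B U k1) +
               card (mirror_ints K2 Q (z U ` {1..F'}) U k1)) ` {1..K1})) \<and>
           (\<forall>k1\<in>{1..K1}. \<forall>s\<in>dom (mirror_msg sch U d k1).
              (\<forall>f\<in>z U ` {1..F'}. \<forall>k2. (k1, k2) \<in> U \<and> Q k1 f k2 = Num s \<longrightarrow> Q0 f k1 = Star) \<longrightarrow>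
              mirror_can_form N sch U d k1 s))))"
proof (intro conjI allI impI)
  show "\<exists>z. \<forall>U. active_set K1 K2 K' U \<longrightarrow> row_listing K' F F' Q0 Q B U (z U)"
    using is_HHPDA_ex_listing[OF assms(1)] by metis
next
  fix z assume z: "\<forall>U. active_set K1 K2 K' U \<longrightarrow> row_listing K' F F' Q0 Q B U (z U)"
  define sch where "sch = algorithm K2 K' F F' S Q0 Q B G N z"
  have pos: "0 < F'" "0 < K1" using is_HHPDA_pos[OF assms(1)] by simp_all
  \<comment> \<open>Since 0 and 1 differ in a field, a packet carries at least one bit; this allows
    \<open>m\<close> to be cancelled in \<open>size\<close>.\<close>
  have "m \<noteq> 0"
  proof
    assume "m = 0"
    hence "card (UNIV :: 'a set) = 1" using assms(3) by simp
    thus False by (metis UNIV_I card_1_singletonE singletonD zero_neq_one)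
  qed
  have log: "log 2 (real CARD('a)) = real m" by (simp add: assms(3) log_nat_power)
  \<comment> \<open>Every label stands for \<open>m\<close> bits and a file has
    \<open>F' * m\<close> bits. The label type is left general because caches and transmissions are
    labelled differently.\<close>
  have size: "size_in_files Bits c = real (card (dom c)) / real F'"
    for c :: "('l, 'a) packets"
    using \<open>m \<noteq> 0\<close> by (simp add: size_in_files_def log assms(4))
  have char2: "x + x = 0" for x :: 'a
    using double_eq_0_if_card_power_2[OF assms(3)] .
  have delivery: "hhpda_delivery K1 K2 K' F F' Z1 Z2 Z' N S Sm Q0 B Q U (z U) d"
    if "active_set K1 K2 K' U" "d \<in> {1..K'} \<rightarrow> {1..N}" for U d
    using assms(1) z that by unfold_locales auto
  have sub: "subpacketization sch = F'" by (simp add: sch_def algorithm_def)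
  \<comment> \<open>Each star in a column accounts for one cached packet of each of the
    \<open>N\<close> files, and a packet is a fraction \<open>1 / F'\<close> of a file.\<close>
  have "hotplug_scheme Bits K1 K2 K' (real (N * Z1) / real F') (real (N * Z2) / real F') N sch"
    unfolding hotplug_scheme_def sub
  proof (intro conjI ballI allI impI)
    show "real Bits = real F' * log 2 (real CARD('a))" by (simp add: log assms(4))
  next
    fix k1 assume k1: "k1 \<in> {1..K1}"
    show "finite (dom (mirror_cache sch k1))" by (simp add: sch_def dom_mirror_cache)
    have "card {f\<in>{1..F}. Q0 f k1 = Star} = Z1"
      using is_HHPDA_mirror_stars[OF assms(1)] k1 by blast
    thus "size_in_files Bits (mirror_cache sch k1) = real (N * Z1) / real F'"
      by (simp add: size sch_def dom_mirror_cache card_cartesian_product)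
  next
    fix u assume "u \<in> {1..K1} \<times> {1..K2}"
    then obtain k1 k2 where u: "u = (k1, k2)" "k1 \<in> {1..K1}" "k2 \<in> {1..K2}" by blast
    show "finite (dom (user_cache sch u))" by (simp add: sch_def dom_user_cache u(1))
    have "card {f\<in>{1..F}. Q k1 f k2 = Star} = Z2"
      using is_HHPDA_user_stars[OF assms(1)] u by blast
    thus "size_in_files Bits (user_cache sch u) = real (N * Z2) / real F'"
      by (simp add: size sch_def dom_user_cache u(1) card_cartesian_product)
  next
    fix U d assume "active_set K1 K2 K' U \<and> d \<in> {1..K'} \<rightarrow> {1..N}"
    then interpret hhpda_delivery K1 K2 K' F F' Z1 Z2 Z' N S Sm Q0 B Q U "z U" d
      using delivery by blast
    show "finite (dom (server_msg sch U d))"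
      unfolding sch_def dom_server_msg by (rule finite_S)
    show "finite (dom (mirror_msg sch U d k1))" for k1
      unfolding sch_def by (rule finite_dom_mirror_msg) simp
    show "\<exists>decode. \<forall>W\<in>libraries N F'.
        decode (content (mirror_msg sch U d (fst u)) W) (content (user_cache sch u) W)
          = W (d (lex_pos U u))" if "u \<in> U" for u
      unfolding sch_def by (rule user_decodes[where y = z, OF char2 assms(5) refl that])
  qed
  hence scheme: "\<exists>M1 M2. hotplug_scheme Bits K1 K2 K' M1 M2 N sch \<and>
      M1 / real N = real Z1 / real F' \<and> M2 / real N = real Z2 / real F'"
    using assms(2)
    by (intro exI[of _ "real (N * Z1) / real F'"] exI[of _ "real (N * Z2) / real F'"]) simp
  have loads: "server_load Bits sch U d = real (card S) / real F' \<and>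
      mirror_load Bits K1 sch U d =
        1 / real F' * real (Max ((\<lambda>k1. card (server_ints K' F' B U k1) +
          card (mirror_ints K2 Q (z U ` {1..F'}) U k1)) ` {1..K1})) \<and>
      (\<forall>k1\<in>{1..K1}. \<forall>s\<in>dom (mirror_msg sch U d k1).
        (\<forall>f\<in>z U ` {1..F'}. \<forall>k2. (k1, k2) \<in> U \<and> Q k1 f k2 = Num s \<longrightarrow> Q0 f k1 = Star) \<longrightarrow>
        mirror_can_form N sch U d k1 s)"
    if "active_set K1 K2 K' U \<and> d \<in> {1..K'} \<rightarrow> {1..N}" for U d
  proof -
    interpret hhpda_delivery K1 K2 K' F F' Z1 Z2 Z' N S Sm Q0 B Q U "z U" d
      using delivery that by blast
    let ?c = "\<lambda>k1. card (server_ints K' F' B U k1) + card (mirror_ints K2 Q (z U ` {1..F'}) U k1)"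
    have "mirror_load Bits K1 sch U d = Max ((\<lambda>k1. real (?c k1) / real F') ` {1..K1})"
      unfolding mirror_load_def size sch_def
      by (intro arg_cong[of _ _ Max] image_cong refl) (simp add: card_dom_mirror_msg)
    also have "\<dots> = Max ((\<lambda>n. real n / real F') ` ?c ` {1..K1})"
      by (simp only: image_image)
    \<comment> \<open>Division by \<open>F'\<close> is monotone, so it commutes with the maximum
      over the finite set of mirrors, which is nonempty because \<open>0 < K1\<close>.\<close>
    also have "\<dots> = real (Max (?c ` {1..K1})) / real F'"
      using pos by (intro mono_Max_commute[symmetric]) (auto intro!: monoI divide_right_mono)
    finally have "mirror_load Bits K1 sch U d = 1 / real F' * real (Max (?c ` {1..K1}))"
      by simp
    moreover have "server_load Bits sch U d = real (card S) / real F'"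
      unfolding server_load_def size sch_def dom_server_msg ..
    moreover have "mirror_can_form N sch U d k1 s"
      if "k1 \<in> {1..K1}" "s \<in> dom (mirror_msg sch U d k1)"
        "\<forall>f\<in>z U ` {1..F'}. \<forall>k2. (k1, k2) \<in> U \<and> Q k1 f k2 = Num s \<longrightarrow> Q0 f k1 = Star" for k1 s
      using that mirror_forms[where y = z, OF refl] unfolding sch_def by blast
    ultimately show ?thesis by blast
  qed
  show "let sch = algorithm K2 K' F F' S Q0 Q B G N z in
        (\<exists>M1 M2. hotplug_scheme Bits K1 K2 K' M1 M2 N sch \<and>
           M1 / real N = real Z1 / real F' \<and> M2 / real N = real Z2 / real F') \<and>
        subpacketization sch = F' \<and>
        (\<forall>U d. active_set K1 K2 K' U \<and> d \<in> {1..K'} \<rightarrow> {1..N} \<longrightarrow>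
           server_load Bits sch U d = real (card S) / real F' \<and>
           mirror_load Bits K1 sch U d =
             1 / real F' * real (Max ((\<lambda>k1. card (server_ints K' F' B U k1) +
               card (mirror_ints K2 Q (z U ` {1..F'}) U k1)) ` {1..K1})) \<and>
           (\<forall>k1\<in>{1..K1}. \<forall>s\<in>dom (mirror_msg sch U d k1).
              (\<forall>f\<in>z U ` {1..F'}. \<forall>k2. (k1, k2) \<in> U \<and> Q k1 f k2 = Num s \<longrightarrow> Q0 f k1 = Star) \<longrightarrow>
              mirror_can_form N sch U d k1 s))"
    unfolding Let_def sch_def[symmetric] using scheme sub loads by blast
qed

end
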